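(* For every $n\in\mathbb{Z}$, the function $$I_n(z_1,z_2)=\frac{n+z_1/z_2}{\sin(2\pi z_1/z_2)}$$ is a slowly increasing holomorphic function on $\mathbb{R}^2\times i\gamma_{p_n}\subseteq\mathbb{C}^2$, where $\gamma_{p_0}=\{(y_1,y_2)\in\mathbb{R}^2:|y_1|<y_2/2\}$ and $\gamma_{p_n}=\{(y_1,y_2)\in\mathbb{R}^2:|y_1|<y_2/2,\ y_1>0\}$ for $n\neq0$.
   Context: Here $\mathbb{C}^2=\mathrm{Lie}(T\times S^1)_{\mathbb{C}}$ for $G=SU(2)$, with coordinates $z_j=x_j+iy_j$, and $\mathbb{R}^2\times i\gamma=\{z\in\mathbb{C}^2:\mathrm{Im}(z)\in\gamma\}$. For $n=0$ the removable singularity of $I_0$ along $z_1=0$ is filled in. A holomorphic function $F$ on $\mathbb{R}^2\times i\gamma$ is slowly increasing if for every compact $K\subseteq\gamma$ and every $\epsilon>0$ there exist constants $M,C>0$ such that for all $z\in\mathbb{R}^2\times iK$ with $|\mathrm{Re}(z)|>M$ one has $|F(z)|\leq C\exp(\epsilon|\mathrm{Re}(z)|)$. *)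

theory Defs
  imports "HOL-Analysis.Analysis"
begin

definition Re_vec :: "complex ^ 'n \<Rightarrow> real ^ 'n"
  where "Re_vec z = (\<chi> i. Re (z $ i))"

definition Im_vec :: "complex ^ 'n \<Rightarrow> real ^ 'n"
  where "Im_vec z = (\<chi> i. Im (z $ i))"

definition tube :: "(real ^ 'n) set \<Rightarrow> (complex ^ 'n) set"
  where "tube \<gamma> = {z. Im_vec z \<in> \<gamma>}"

text \<open>
  The library's \<open>holomorphic_on\<close> covers one complex variable only. In several variables,
  holomorphic on an open set means that at every point the real Frechet derivative exists and
  is complex linear.
\<close>
definition holomorphic_vec_on :: "(complex ^ 'n \<Rightarrow> complex) \<Rightarrow> (complex ^ 'n) set \<Rightarrow> bool"
  where "holomorphic_vec_on F U \<longleftrightarrow>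
    open U \<and>
    (\<forall>z\<in>U. \<exists>D. (F has_derivative D) (at z) \<and> Vector_Spaces.linear (*s) (*) D)"

definition slowly_increasing_on_tube :: "(complex ^ 'n \<Rightarrow> complex) \<Rightarrow> (real ^ 'n) set \<Rightarrow> bool"
  where "slowly_increasing_on_tube F \<gamma> \<longleftrightarrow>
    (\<forall>K \<epsilon>. compact K \<and> K \<subseteq> \<gamma> \<and> \<epsilon> > 0 \<longrightarrow>
      (\<exists>M C. M > 0 \<and> C > 0 \<and>
        (\<forall>z\<in>tube K. norm (Re_vec z) > M \<longrightarrow> norm (F z) \<le> C * exp (\<epsilon> * norm (Re_vec z)))))"

definition gamma_p :: "int \<Rightarrow> (real ^ 2) set"
  where "gamma_p n =
    (if n = 0 then {y. \<bar>y $ 1\<bar> < y $ 2 / 2} else {y. \<bar>y $ 1\<bar> < y $ 2 / 2 \<and> y $ 1 > 0})"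

text \<open>
  For \<open>n = 0\<close> the singularity along \<open>z $ 1 = 0\<close> is removable; the value filled in there is
  the limit of \<open>w / sin (2 * pi * w)\<close> as \<open>w\<close> tends to \<open>0\<close>.
\<close>
definition I_fun :: "int \<Rightarrow> complex ^ 2 \<Rightarrow> complex"
  where "I_fun n z =
    (if n = 0 \<and> z $ 1 = 0 then 1 / (2 * of_real pi)
     else (of_int n + z $ 1 / z $ 2) / sin (2 * of_real pi * (z $ 1 / z $ 2)))"

end

theory Submission
  imports Defs "HOL-Complex_Analysis.Cauchy_Integral_Formula"
begin

text \<open>
  Put \<open>w = z $ 1 / z $ 2\<close>. Jordan's inequality extends to the complex strip
  \<open>\<bar>Re s\<bar> \<le> pi / 2\<close>, so by periodicity \<open>\<bar>sin (2 * pi * w)\<bar> \<ge> 4 * \<bar>w - k / 2\<bar>\<close> for the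
  integer \<open>k\<close> nearest to \<open>2 * Re w\<close>. Passing to imaginary parts,
  \<open>\<bar>z $ 1 - (k / 2) * z $ 2\<bar> \<ge> \<bar>y\<^sub>1 - k * y\<^sub>2 / 2\<bar>\<close>, which is bounded below on compact
  subsets of the cone unless \<open>n = k = 0\<close>. The factor \<open>z $ 2\<close> cancels, so the function grows at most
  linearly, except where \<open>n = k = 0\<close>; there it is bounded by \<open>1 / 4\<close>.
\<close>

section \<open>Lower bounds for the complex sine in terms of the distance to its zeros\<close>

lemma jordan_inequality:
  fixes a :: real
  assumes "\<bar>a\<bar> \<le> pi / 2"
  shows "2 / pi * \<bar>a\<bar> \<le> \<bar>sin a\<bar>"
proof -
  have "concave_on {0..pi} sin"
    by (rule f''_le0_imp_concave[where f' = cos and f'' = "\<lambda>x. - sin x"])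
      (auto intro: sin_ge_zero)
  \<comment> \<open>The chord of the sine from 0 to \<open>pi / 2\<close> has slope
    \<open>2 / pi\<close>. Concavity puts the graph above it, and oddness covers negative
    \<open>a\<close>.\<close>
  from concave_onD[OF this, of "2 / pi * \<bar>a\<bar>" 0 "pi / 2"] assms
  have "2 / pi * \<bar>a\<bar> \<le> sin \<bar>a\<bar>"
    by (simp add: field_simps)
  then show ?thesis
    by (simp add: abs_if split: if_splits)
qed

lemma abs_le_abs_sinh: "\<bar>b\<bar> \<le> \<bar>sinh b\<bar>" for b :: real
  using real_le_abs_sinh[of b] by (simp only: sinh_field_def exp_minus)

text \<open>The squared norm of \<open>sin s\<close> is the sum of the squares of
  \<open>sin (Re s)\<close> and \<open>sinh (Im s)\<close>, so each part can be bounded separately: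
  Jordan's inequality handles the real part, and \<open>abs_le_abs_sinh\<close> with
  \<open>2 / pi \<le> 1\<close> the imaginary part.\<close>

lemma norm_sin_ge_strip:
  assumes "\<bar>Re s\<bar> \<le> pi / 2"
  shows "2 / pi * norm s \<le> norm (sin s)"
proof (rule power2_le_imp_le)
  have "(norm (sin s))\<^sup>2 = (sin (Re s))\<^sup>2 + (sinh (Im s))\<^sup>2"
  proof -
    have c: "(cosh (Im s))\<^sup>2 = 1 + (sinh (Im s))\<^sup>2"
      by (simp add: cosh_square_eq)
    have "sin s = Complex (sin (Re s) * cosh (Im s)) (cos (Re s) * sinh (Im s))"
      by (simp add: complex_eq_iff Re_sin Im_sin cosh_def sinh_def exp_minus)
    then have "(norm (sin s))\<^sup>2
        = (sin (Re s))\<^sup>2 * (cosh (Im s))\<^sup>2 + (cos (Re s))\<^sup>2 * (sinh (Im s))\<^sup>2"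
      by (simp add: cmod_power2 power_mult_distrib)
    also have "\<dots> = (sin (Re s))\<^sup>2 + (sinh (Im s))\<^sup>2"
      unfolding c cos_squared_eq by (simp add: algebra_simps)
    finally show ?thesis .
  qed
  moreover have "(2 / pi * \<bar>Re s\<bar>)\<^sup>2 \<le> (sin (Re s))\<^sup>2"
    using power_mono[OF jordan_inequality[OF assms], of 2] by simp
  moreover have "(2 / pi * \<bar>Im s\<bar>)\<^sup>2 \<le> (sinh (Im s))\<^sup>2"
  proof -
    have "2 / pi * \<bar>Im s\<bar> \<le> 1 * \<bar>Im s\<bar>"
      by (rule mult_right_mono) (use pi_ge_two in auto)
    also have "\<dots> \<le> \<bar>sinh (Im s)\<bar>"
      using abs_le_abs_sinh by simp
    finally have "2 / pi * \<bar>Im s\<bar> \<le> \<bar>sinh (Im s)\<bar>" .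
    from power_mono[OF this, of 2] show ?thesis
      by simp
  qed
  ultimately show "(2 / pi * norm s)\<^sup>2 \<le> (norm (sin s))\<^sup>2"
    by (simp add: power_mult_distrib power_divide cmod_power2 ring_distribs add_divide_distrib)
qed simp

text \<open>The points \<open>k / 2\<close> are the zeros of \<open>sin (2 * pi * w)\<close>. The
  constant 4 is the factor \<open>2 / pi\<close> of the strip estimate times the factor
  \<open>2 * pi\<close> by which \<open>s\<close> rescales the distance to the nearest zero.\<close>

lemma norm_sin_ge_dist_half_int:
  fixes w :: complex
  obtains k :: int where "4 * norm (w - of_int k / 2) \<le> norm (sin (2 * of_real pi * w))"
proof
  define k where "k = round (2 * Re w)"
  define s where "s = 2 * of_real pi * (w - of_int k / 2)"
  have "\<bar>real_of_int k - 2 * Re w\<bar> \<le> 1 / 2"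
    unfolding k_def by (rule of_int_round_abs_le)
  then have "\<bar>2 * Re w - real_of_int k\<bar> \<le> 1 / 2"
    by (simp only: abs_minus_commute)
  then have "\<bar>2 * Re w - real_of_int k\<bar> * pi \<le> 1 / 2 * pi"
    by (intro mult_right_mono) auto
  moreover have "Re s = (2 * Re w - real_of_int k) * pi"
    by (simp add: s_def algebra_simps)
  ultimately have "\<bar>Re s\<bar> \<le> pi / 2"
    by (simp add: abs_mult)
  then have "2 / pi * norm s \<le> norm (sin s)"
    by (rule norm_sin_ge_strip)
  moreover have "norm s = 2 * pi * norm (w - of_int k / 2)"
    by (simp add: s_def norm_mult)
  moreover have "norm (sin s) = norm (sin (2 * of_real pi * w))"
  proof -
    \<comment> \<open>Translation by \<open>pi * k\<close> changes the sine only by a sign, so the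
      norm is unaffected.\<close>
    have eq: "2 * of_real pi * w = s + of_real (pi * of_int k)"
      by (simp add: s_def algebra_simps)
    have "sin (of_real (pi * of_int k) :: complex) = 0"
      by (simp only: sin_of_real) simp
    moreover have "cos (of_real (pi * of_int k)) = (of_real (if even k then 1 else -1) :: complex)"
      by (simp only: cos_of_real cos_npi_int)
    ultimately show ?thesis
      unfolding eq sin_add by (simp add: norm_mult)
  qed
  ultimately show "4 * norm (w - of_int k / 2) \<le> norm (sin (2 * of_real pi * w))"
    by simp
qed

text \<open>\<open>n\<close> is a switch for the zero at \<open>k = 0\<close>: if
  \<open>n \<noteq> 0\<close>, the bound on \<open>Im a\<close> keeps \<open>a / b\<close> away from
  it; if \<open>n = 0\<close>, the second alternative retains the distance to it as a lower
  bound.\<close>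

lemma norm_sin_quotient_ge:
  fixes a b :: complex and \<delta> :: real
  assumes b: "0 < Im b" and d: "0 < \<delta>" "\<delta> \<le> Im b / 2 - \<bar>Im a\<bar>" and n: "n \<noteq> 0 \<Longrightarrow> \<delta> \<le> Im a"
  shows "4 * \<delta> / norm b \<le> norm (sin (2 * of_real pi * (a / b))) \<or>
    n = 0 \<and> 4 * norm (a / b) \<le> norm (sin (2 * of_real pi * (a / b)))"
proof -
  have "b \<noteq> 0"
    using b by auto
  obtain k :: int
    where k: "4 * norm (a / b - of_int k / 2) \<le> norm (sin (2 * of_real pi * (a / b)))"
    by (rule norm_sin_ge_dist_half_int)
  show ?thesis
  proof (cases "n = 0 \<and> k = 0")
    case True
    then show ?thesis
      using k by simp
  next
    case False
    have "\<delta> \<le> \<bar>Im a - real_of_int k / 2 * Im b\<bar>"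
    proof (cases "k = 0")
      case True
      then show ?thesis
        using False n by auto
    next
      case k0: False
      \<comment> \<open>For \<open>k \<noteq> 0\<close>, the term \<open>k / 2 * Im b\<close> has
        absolute value at least \<open>Im b / 2\<close>, which exceeds
        \<open>\<bar>Im a\<bar>\<close> by at least \<open>\<delta>\<close>.\<close>
      then have "1 \<le> \<bar>real_of_int k\<bar>"
        by linarith
      then have "1 * (Im b / 2) \<le> \<bar>real_of_int k\<bar> * (Im b / 2)"
        by (rule mult_right_mono) (use b in auto)
      also have "\<dots> = \<bar>real_of_int k / 2 * Im b\<bar>"
        using b by (simp add: abs_mult)
      finally show ?thesis
        using d by linarith
    qed
    also have "\<dots> \<le> norm (a - of_int k / 2 * b)"
      using abs_Im_le_cmod[of "a - of_int k / 2 * b"] by simp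
    also have "\<dots> = norm (a / b - of_int k / 2) * norm b"
      using \<open>b \<noteq> 0\<close> by (simp add: left_diff_distrib flip: norm_mult)
    finally have "4 * \<delta> / norm b \<le> 4 * norm (a / b - of_int k / 2)"
      using \<open>b \<noteq> 0\<close> by (simp add: field_simps)
    with k show ?thesis
      by linarith
  qed
qed

section \<open>Zero-freeness of the denominator on the tube\<close>

lemma tube_gamma_pD:
  assumes "z \<in> tube (gamma_p n)"
  shows "\<bar>Im (z $ 1)\<bar> < Im (z $ 2) / 2" "n \<noteq> 0 \<Longrightarrow> 0 < Im (z $ 1)" "0 < Im (z $ 2)"
proof -
  show "\<bar>Im (z $ 1)\<bar> < Im (z $ 2) / 2" "n \<noteq> 0 \<Longrightarrow> 0 < Im (z $ 1)"
    using assms by (auto simp: tube_def Im_vec_def gamma_p_def split: if_splits)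
  then show "0 < Im (z $ 2)"
    by linarith
qed

lemma sin_quotient_nonzero:
  assumes z: "z \<in> tube (gamma_p n)" and "n \<noteq> 0 \<or> z $ 1 \<noteq> 0"
  shows "sin (2 * of_real pi * (z $ 1 / z $ 2)) \<noteq> 0"
proof
  assume zero: "sin (2 * of_real pi * (z $ 1 / z $ 2)) = 0"
  \<comment> \<open>At a single point, the exact margin in the inequalities defining
    \<open>gamma_p n\<close> can serve as \<open>\<delta>\<close>.\<close>
  define \<delta> where
    "\<delta> = (if n = 0 then Im (z $ 2) / 2 - \<bar>Im (z $ 1)\<bar>
          else min (Im (z $ 2) / 2 - \<bar>Im (z $ 1)\<bar>) (Im (z $ 1)))"
  note D = tube_gamma_pD[OF z]
  have d: "0 < \<delta>" "\<delta> \<le> Im (z $ 2) / 2 - \<bar>Im (z $ 1)\<bar>" "n \<noteq> 0 \<Longrightarrow> \<delta> \<le> Im (z $ 1)"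
    using D(1,2) by (auto simp: \<delta>_def)
  have nz: "z $ 2 \<noteq> 0"
    using D(3) by auto
  then have "0 < 4 * \<delta> / norm (z $ 2)"
    using d(1) by simp
  then have "\<not> 4 * \<delta> / norm (z $ 2) \<le> 0"
    by (simp only: not_le)
  then have "n = 0 \<and> 4 * norm (z $ 1 / z $ 2) \<le> 0"
    using norm_sin_quotient_ge[OF D(3) d] unfolding zero norm_zero by blast
  then show False
    using assms(2) nz by auto
qed

section \<open>Holomorphy, including the removable singularity for \<open>n = 0\<close>\<close>

lemma open_tube_gamma_p: "open (tube (gamma_p n))"
proof -
  have "tube (gamma_p n) = (if n = 0 then {z. \<bar>Im (z $ 1)\<bar> < Im (z $ 2) / 2}
      else {z. \<bar>Im (z $ 1)\<bar> < Im (z $ 2) / 2} \<inter> {z. 0 < Im (z $ 1)})"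
    by (auto simp: tube_def gamma_p_def Im_vec_def)
  also have "open \<dots>"
    by (auto intro!: open_Int open_Collect_less continuous_intros)
  finally show ?thesis .
qed

text \<open>Passing to the reciprocal turns the removable singularity of the case
  \<open>n = 0\<close> into that of a difference quotient of \<open>sin (2 * pi * w)\<close> at 0,
  whose value there has to be the derivative \<open>2 * pi\<close>.\<close>

definition quotient_sin :: "complex \<Rightarrow> complex" where
  "quotient_sin w = (if w = 0 then 2 * of_real pi else sin (2 * of_real pi * w) / w)"

lemma quotient_sin_holomorphic: "quotient_sin holomorphic_on UNIV"
proof -
  have d: "((\<lambda>w::complex. sin (2 * of_real pi * w)) has_field_derivative 2 * of_real pi) (at 0)"
    by (auto intro!: derivative_eq_intros)
  have "(\<lambda>w::complex. sin (2 * of_real pi * w)) holomorphic_on UNIV"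
    by (intro holomorphic_intros)
  then have "(\<lambda>z. if z = 0 then deriv (\<lambda>w::complex. sin (2 * of_real pi * w)) 0
      else (sin (2 * of_real pi * z) - sin (2 * of_real pi * 0)) / (z - 0)) holomorphic_on UNIV"
    by (rule pole_lemma_open) simp
  then show ?thesis
    by (simp add: DERIV_imp_deriv[OF d] quotient_sin_def[abs_def] cong: if_cong)
qed

lemma has_derivative_quotient_complex_linear:
  fixes z :: "complex ^ 'n" and G :: "complex \<Rightarrow> complex"
  assumes G: "(G has_field_derivative G') (at (z $ i / z $ j))" and nz: "z $ j \<noteq> 0"
  shows "\<exists>D. ((\<lambda>z. G (z $ i / z $ j)) has_derivative D) (at z) \<and> Vector_Spaces.linear (*s) (*) D"
proof -
  \<comment> \<open>The differential of \<open>z $ i / z $ j\<close> by the quotient rule. It is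
    complex linear in \<open>h\<close>, and the chain rule only multiplies it by
    \<open>G'\<close>.\<close>
  define q where "q h = (h $ i * z $ j - z $ i * h $ j) / (z $ j * z $ j)" for h :: "complex ^ 'n"
  have nth: "((\<lambda>z :: complex ^ 'n. z $ l) has_derivative (\<lambda>h. h $ l)) (at z)" for l
    by (rule bounded_linear_imp_has_derivative[OF bounded_linear_vec_nth])
  have "((\<lambda>z. z $ i / z $ j) has_derivative q) (at z)"
    unfolding q_def by (rule has_derivative_divide'[OF nth nth nz])
  from has_derivative_compose[OF this G[unfolded has_field_derivative_def]]
  have "((\<lambda>z. G (z $ i / z $ j)) has_derivative (\<lambda>h. G' * q h)) (at z)" .
  moreover have "Vector_Spaces.linear (*s) (*) (\<lambda>h. G' * q h)"
    unfolding Vector_Spaces.linear_iff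
    by (auto simp: vec.vector_space_axioms vector_space_over_itself.vector_space_axioms
        q_def algebra_simps add_divide_distrib diff_divide_distrib)
  ultimately show ?thesis
    by blast
qed

lemma I_fun_0_eq: "z $ 2 \<noteq> 0 \<Longrightarrow> I_fun 0 z = inverse (quotient_sin (z $ 1 / z $ 2))"
  by (simp add: I_fun_def quotient_sin_def inverse_eq_divide)

lemma I_fun_holomorphic: "holomorphic_vec_on (I_fun n) (tube (gamma_p n))"
  unfolding holomorphic_vec_on_def
proof (intro conjI ballI open_tube_gamma_p)
  fix z assume z: "z \<in> tube (gamma_p n)"
  define w where "w = z $ 1 / z $ 2"
  define G where "G u = (if n = 0 then inverse (quotient_sin u)
      else (of_int n + u) / sin (2 * of_real pi * u))" for u
  have nz: "z $ 2 \<noteq> 0"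
    using tube_gamma_pD(3)[OF z] by auto
  \<comment> \<open>Restricting to the tube matters for \<open>n = 0\<close>: where
    \<open>x $ 2 = 0\<close> and \<open>x $ 1 \<noteq> 0\<close>, division by zero makes
    \<open>I_fun 0 x\<close> equal to 0, whereas \<open>G 0\<close> is
    \<open>1 / (2 * pi)\<close>.\<close>
  have eq: "I_fun n x = G (x $ 1 / x $ 2)" if "x \<in> tube (gamma_p n)" for x
  proof (cases "n = 0")
    case True
    have "x $ 2 \<noteq> 0"
      using tube_gamma_pD(3)[OF that] by auto
    then show ?thesis
      using True by (simp add: G_def I_fun_0_eq)
  qed (simp add: G_def I_fun_def)
  have "G field_differentiable (at w)"
  proof (cases "n = 0")
    case True
    have "quotient_sin w \<noteq> 0"
      using sin_quotient_nonzero[OF z] nz True by (auto simp: quotient_sin_def w_def)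
    moreover have "quotient_sin field_differentiable (at w)"
      using quotient_sin_holomorphic by (simp add: holomorphic_on_def)
    ultimately have "(\<lambda>u. inverse (quotient_sin u)) field_differentiable (at w)"
      by (intro field_differentiable_inverse)
    then show ?thesis
      using True by (simp add: G_def[abs_def])
  next
    case False
    then have "sin (2 * of_real pi * w) \<noteq> 0"
      using sin_quotient_nonzero[OF z] by (simp add: w_def)
    moreover have "(\<lambda>u. of_int n + u) field_differentiable (at w)"
      by (intro derivative_intros)
    moreover have "(\<lambda>u::complex. sin (2 * of_real pi * u)) field_differentiable (at w)"
      by (auto simp: field_differentiable_def intro!: derivative_eq_intros exI)
    ultimately have "(\<lambda>u. (of_int n + u) / sin (2 * of_real pi * u)) field_differentiable (at w)"
      by (intro field_differentiable_divide)
    then show ?thesis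
      using False by (simp add: G_def[abs_def])
  qed
  then obtain G' where "(G has_field_derivative G') (at (z $ 1 / z $ 2))"
    by (auto simp: field_differentiable_def w_def)
  from has_derivative_quotient_complex_linear[OF this nz]
  obtain D where D: "((\<lambda>z. G (z $ 1 / z $ 2)) has_derivative D) (at z)"
      "Vector_Spaces.linear (*s) (*) D"
    by blast
  have "(I_fun n has_derivative D) (at z)"
    by (rule has_derivative_transform_within_open[OF D(1) open_tube_gamma_p z]) (simp add: eq)
  with D(2) show "\<exists>D. (I_fun n has_derivative D) (at z) \<and> Vector_Spaces.linear (*s) (*) D"
    by blast
qed

section \<open>Growth estimates\<close>

lemma norm_I_fun_le:
  assumes z: "z \<in> tube (gamma_p n)"
    and d: "0 < \<delta>" "\<delta> \<le> Im (z $ 2) / 2 - \<bar>Im (z $ 1)\<bar>" "n \<noteq> 0 \<Longrightarrow> \<delta> \<le> Im (z $ 1)"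
  shows "norm (I_fun n z) \<le> (\<bar>of_int n\<bar> + 1) / (4 * \<delta>) * norm z + 1 / 4"
proof -
  define w where "w = z $ 1 / z $ 2"
  define S where "S = sin (2 * of_real pi * w)"
  have pos: "0 < Im (z $ 2)"
    by (rule tube_gamma_pD(3)[OF z])
  then have nz: "z $ 2 \<noteq> 0"
    by auto
  \<comment> \<open>The two summands of the bound come from different cases. A case that yields only
    \<open>1 / 4\<close> is padded with the nonnegative linear term.\<close>
  have nonneg: "0 \<le> (\<bar>real_of_int n\<bar> + 1) / (4 * \<delta>) * norm z"
    using d(1) by simp
  show ?thesis
  proof (cases "n = 0 \<and> z $ 1 = 0")
    case True
    then have "norm (I_fun n z) = 1 / (2 * pi)"
      by (simp add: I_fun_def norm_divide norm_mult)
    also have "\<dots> \<le> 1 / 4"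
      using pi_ge_two by (intro divide_left_mono) auto
    finally show ?thesis
      using nonneg by linarith
  next
    case False
    then have I: "I_fun n z = (of_int n + w) / S"
      by (auto simp: I_fun_def w_def S_def)
    have S0: "S \<noteq> 0"
      using sin_quotient_nonzero[OF z] False by (auto simp: S_def w_def)
    consider "4 * \<delta> / norm (z $ 2) \<le> norm S" | "n = 0" "4 * norm w \<le> norm S"
      using norm_sin_quotient_ge[OF pos d] unfolding S_def w_def by blast
    then show ?thesis
    proof cases
      case 1
      have "norm (I_fun n z) = norm (of_int n + w) / norm S"
        by (simp add: I norm_divide)
      also have "\<dots> \<le> norm (of_int n + w) / (4 * \<delta> / norm (z $ 2))"
        using 1 d(1) nz S0 by (intro divide_left_mono) auto
      also have "\<dots> = norm ((of_int n + w) * z $ 2) / (4 * \<delta>)"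
        by (simp add: norm_mult)
      also have "\<dots> = norm (of_int n * z $ 2 + z $ 1) / (4 * \<delta>)"
        using nz by (simp add: w_def distrib_right)
      also have "\<dots> \<le> ((\<bar>of_int n\<bar> + 1) * norm z) / (4 * \<delta>)"
      proof (rule divide_right_mono)
        have "norm (of_int n * z $ 2 + z $ 1) \<le> \<bar>of_int n\<bar> * norm (z $ 2) + norm (z $ 1)"
          by (rule norm_triangle_le) (simp add: norm_mult)
        also have "\<dots> \<le> \<bar>of_int n\<bar> * norm z + norm z"
          by (intro add_mono mult_left_mono) (auto simp: Finite_Cartesian_Product.norm_nth_le)
        finally show "norm (of_int n * z $ 2 + z $ 1) \<le> (\<bar>of_int n\<bar> + 1) * norm z"
          by (simp add: algebra_simps)
      qed (use d in auto)
      finally show ?thesis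
        by simp
    next
      case 2
      have "norm (I_fun n z) = norm w / norm S"
        unfolding I using 2 by (simp add: norm_divide)
      also have "\<dots> \<le> 1 / 4"
        using 2 S0 by (simp add: field_simps)
      finally show ?thesis
        using nonneg by linarith
    qed
  qed
qed

text \<open>The inequality \<open>\<bar>Re\<bar> + \<bar>Im\<bar>\<close> for the modulus holds in
  each coordinate; Minkowski's inequality then separates the two parts.\<close>

lemma norm_le_norm_Re_vec_Im_vec: "norm z \<le> norm (Re_vec z) + norm (Im_vec z)"
proof -
  have "norm z \<le> L2_set (\<lambda>i. \<bar>Re (z $ i)\<bar> + \<bar>Im (z $ i)\<bar>) UNIV"
    unfolding norm_vec_def by (intro L2_set_mono cmod_le) auto
  also have "\<dots> \<le> norm (Re_vec z) + norm (Im_vec z)"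
    unfolding norm_vec_def Re_vec_def Im_vec_def
    using L2_set_triangle_ineq by simp
  finally show ?thesis .
qed

lemma compact_gamma_p_margin:
  assumes K: "compact K" "K \<subseteq> gamma_p n"
  obtains \<delta> where "0 < \<delta>" "\<And>y. y \<in> K \<Longrightarrow> \<delta> \<le> y $ 2 / 2 - \<bar>y $ 1\<bar>"
    "\<And>y. y \<in> K \<Longrightarrow> n \<noteq> 0 \<Longrightarrow> \<delta> \<le> y $ 1"
proof (cases "K = {}")
  case True
  then show ?thesis
    using that[of 1] by simp
next
  case False
  \<comment> \<open>The minimum of this continuous margin over the nonempty compact set
    \<open>K\<close> is the uniform \<open>\<delta>\<close>. For \<open>n = 0\<close> both arguments
    of \<open>min\<close> coincide, so one formula covers both shapes of the cone.\<close>
  define g where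
    "g y = min (y $ 2 / 2 - \<bar>y $ 1\<bar>) (if n = 0 then y $ 2 / 2 - \<bar>y $ 1\<bar> else y $ 1)" for y :: "real ^ 2"
  have "continuous_on K g"
    unfolding g_def[abs_def] by (cases "n = 0") (auto intro!: continuous_intros)
  from continuous_attains_inf[OF K(1) False this]
  obtain x where x: "x \<in> K" and le: "\<And>y. y \<in> K \<Longrightarrow> g x \<le> g y"
    by blast
  have "0 < g x"
    using x K(2) by (auto simp: g_def gamma_p_def split: if_splits)
  then show ?thesis
    using le by (intro that[of "g x"]) (force simp: g_def)+
qed

lemma I_fun_slowly_increasing: "slowly_increasing_on_tube (I_fun n) (gamma_p n)"
  unfolding slowly_increasing_on_tube_def
proof (intro allI impI, elim conjE)
  fix K :: "(real ^ 2) set" and \<epsilon> :: real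
  assume K: "compact K" "K \<subseteq> gamma_p n" and \<epsilon>: "0 < \<epsilon>"
  from compact_gamma_p_margin[OF K]
  obtain \<delta> where \<delta>: "0 < \<delta>" "\<And>y. y \<in> K \<Longrightarrow> \<delta> \<le> y $ 2 / 2 - \<bar>y $ 1\<bar>"
    "\<And>y. y \<in> K \<Longrightarrow> n \<noteq> 0 \<Longrightarrow> \<delta> \<le> y $ 1"
    by blast
  obtain B where B: "0 < B" "\<And>y. y \<in> K \<Longrightarrow> norm y \<le> B"
    using compact_imp_bounded[OF K(1)] bounded_pos by metis
  define A where "A = (\<bar>real_of_int n\<bar> + 1) / (4 * \<delta>)"
  \<comment> \<open>With \<open>E = exp (\<epsilon> * r)\<close>, the inequality
    \<open>1 + \<epsilon> * r \<le> E\<close> gives \<open>r \<le> E / \<epsilon>\<close>, while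
    \<open>1 \<le> E\<close> absorbs \<open>B\<close> and \<open>1 / 4\<close>. Collecting the
    coefficients of \<open>E\<close> in \<open>A * (r + B) + 1 / 4\<close> gives
    \<open>C\<close>.\<close>
  define C where "C = A * (1 / \<epsilon> + B) + 1 / 4"
  have A: "0 < A"
    using \<delta>(1) by (simp add: A_def)
  have "norm (I_fun n z) \<le> C * exp (\<epsilon> * norm (Re_vec z))" if z: "z \<in> tube K" for z
  proof -
    define r where "r = norm (Re_vec z)"
    define E where "E = exp (\<epsilon> * r)"
    have y: "Im_vec z \<in> K"
      using z by (simp add: tube_def)
    have "z \<in> tube (gamma_p n)"
      using y K(2) by (auto simp: tube_def)
    then have "norm (I_fun n z) \<le> A * norm z + 1 / 4"
      unfolding A_def using \<delta>(1) \<delta>(2,3)[OF y]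
      by (intro norm_I_fun_le) (simp_all add: Im_vec_def)
    also have "\<dots> \<le> A * (r + B) + 1 / 4"
      using norm_le_norm_Re_vec_Im_vec[of z] B(2)[OF y] A
      by (intro add_right_mono mult_left_mono) (auto simp: r_def)
    also have "\<dots> \<le> A * (E / \<epsilon> + B * E) + E / 4"
    proof -
      have "1 + \<epsilon> * r \<le> E"
        unfolding E_def by (rule exp_ge_add_one_self)
      then have "r \<le> E / \<epsilon>"
        using \<epsilon> by (simp add: field_simps)
      moreover have "1 \<le> E"
        using \<epsilon> by (simp add: E_def r_def)
      moreover from this have "B \<le> B * E"
        using B(1) by simp
      ultimately show ?thesis
        using A by (intro add_mono mult_left_mono) auto
    qed
    also have "\<dots> = C * E"
      by (simp add: C_def algebra_simps)
    finally show ?thesis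
      by (simp add: E_def r_def)
  qed
  moreover have "0 < C"
    using A B(1) \<epsilon> by (simp add: C_def add_pos_pos)
  ultimately show "\<exists>M C. M > 0 \<and> C > 0 \<and>
      (\<forall>z\<in>tube K. norm (Re_vec z) > M \<longrightarrow> norm (I_fun n z) \<le> C * exp (\<epsilon> * norm (Re_vec z)))"
    \<comment> \<open>\<open>M = 1\<close> is an arbitrary positive choice, the estimate having been
      shown on all of \<open>tube K\<close>.\<close>
    by (intro exI[of _ 1] exI[of _ C]) auto
qed

theorem proposition9:
  fixes n :: int
  shows "holomorphic_vec_on (I_fun n) (tube (gamma_p n)) \<and>
         slowly_increasing_on_tube (I_fun n) (gamma_p n)"
  by (intro conjI I_fun_holomorphic I_fun_slowly_increasing)

end
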